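(* Let $p$ be an odd prime, let $G$ be a finite abelian $p$-group and let $H$ be a maximal elementary abelian subgroup of $G$. If $H\cong\mathbb{Z}_p^k$, then $\omega(\Gamma(G))=\omega(\Gamma(H))=\dfrac{p^k+1}{2}$.
   Context: For a finite group $G$, the prime order element graph $\Gamma(G)$ is the simple undirected graph with vertex set $G$ in which two distinct vertices $x,y\in G$ are adjacent if and only if the order of the product $xy$ is a prime number. $\omega(\Gamma)$ denotes the clique number of a graph $\Gamma$, i.e. the maximum number of vertices in a clique. $\mathbb{Z}_p^k$ is the direct product of $k$ copies of the cyclic group of order $p$. *)

theory Defs
  imports Complex_Main "HOL-Computational_Algebra.Primes"
    "HOL-Algebra.Multiplicative_Group" "HOL-Algebra.Product_Groups"
    "HOL-Algebra.Elementary_Groups" "HOL-Library.Ramsey"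
begin

definition finite_p_group :: "nat \<Rightarrow> ('a, 'b) monoid_scheme \<Rightarrow> bool" where
  "finite_p_group p G \<longleftrightarrow> group G \<and> finite (carrier G) \<and> (\<exists>n. order G = p ^ n)"

text \<open>The trivial group counts as elementary abelian.\<close>

definition elementary_abelian :: "('a, 'b) monoid_scheme \<Rightarrow> bool" where
  "elementary_abelian G \<longleftrightarrow> comm_group G \<and>
     (\<exists>q. prime q \<and> (\<forall>x\<in>carrier G. x \<noteq> \<one>\<^bsub>G\<^esub> \<longrightarrow> group.ord G x = q))"

definition elementary_abelian_subgroup :: "'a set \<Rightarrow> ('a, 'b) monoid_scheme \<Rightarrow> bool" where
  "elementary_abelian_subgroup H G \<longleftrightarrow> subgroup H G \<and> elementary_abelian (G\<lparr>carrier := H\<rparr>)"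

definition maximal_elementary_abelian_subgroup :: "'a set \<Rightarrow> ('a, 'b) monoid_scheme \<Rightarrow> bool" where
  "maximal_elementary_abelian_subgroup H G \<longleftrightarrow> elementary_abelian_subgroup H G \<and>
     (\<forall>K. elementary_abelian_subgroup K G \<and> H \<subseteq> K \<longrightarrow> K = H)"

text \<open>Simple graphs are pairs of a vertex set and a set of two-element edges, matching
  the edge representation used by \<^const>\<open>clique\<close>.\<close>

definition prime_order_element_graph ::
    "('a, 'b) monoid_scheme \<Rightarrow> 'a set \<times> 'a set set" where
  "prime_order_element_graph G =
     (carrier G,
      {{x, y} | x y. x \<in> carrier G \<and> y \<in> carrier G \<and> x \<noteq> y \<and> prime (group.ord G (x \<otimes>\<^bsub>G\<^esub> y))})"

text \<open>Meaningful for graphs with finitely many vertices, where the maximum is over a finite set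
  that is nonempty because of the empty clique.\<close>

definition clique_number :: "'a set \<times> 'a set set \<Rightarrow> nat" where
  "clique_number \<Gamma> = Max {card C | C. C \<subseteq> fst \<Gamma> \<and> clique C (snd \<Gamma>)}"

end

theory Submission
  imports Defs
begin

text \<open>
  The maximal elementary abelian subgroup \<open>H\<close> is the set of all \<open>x\<close> with \<open>x\<^sup>p = 1\<close>, so distinct
  \<open>x\<close> and \<open>y\<close> are adjacent iff \<open>xy \<in> H - {1}\<close>. For distinct \<open>x, y, z\<close> in a clique,
  \<open>x\<^sup>2 = (xy)(xz)(yz)\<^sup>-\<^sup>1 \<in> H\<close> and hence \<open>x \<in> H\<close>, as squaring is injective on a group of odd order;
  so every clique with at least three vertices lies in \<open>H\<close>. The cliques inside \<open>H\<close> are the sets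
  with no two distinct mutually inverse elements, and since only \<open>1\<close> is its own inverse, the largest
  of them contain \<open>1\<close> and one element of each pair \<open>{x, x\<^sup>-\<^sup>1}\<close>.
\<close>

section \<open>Selecting half of a set under an involution\<close>

text \<open>Take \<open>C\<close> maximal with the last property: an element of \<open>S\<close>
  covered neither by \<open>C\<close> nor by its image could still be added. Fixed points of
  \<open>f\<close> are allowed in \<open>C\<close>.\<close>

lemma involution_half:
  assumes fin: "finite S"
    and invol: "\<And>x. x \<in> S \<Longrightarrow> f (f x) = x"
  obtains C where "C \<subseteq> S" "S \<subseteq> C \<union> f ` C" "\<forall>x\<in>C. \<forall>y\<in>C. x \<noteq> y \<longrightarrow> y \<noteq> f x"
proof -
  define F where "F = {C. C \<subseteq> S \<and> (\<forall>x\<in>C. \<forall>y\<in>C. x \<noteq> y \<longrightarrow> y \<noteq> f x)}"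
  have F: "finite F" "F \<noteq> {}"
    using fin by (auto simp: F_def)
  obtain C where "C \<in> F" and max: "\<And>D. D \<in> F \<Longrightarrow> C \<subseteq> D \<Longrightarrow> D = C"
    using finite_has_maximal[OF F] by blast
  then have C: "C \<subseteq> S" "\<forall>x\<in>C. \<forall>y\<in>C. x \<noteq> y \<longrightarrow> y \<noteq> f x"
    by (auto simp: F_def)
  have "x \<in> C \<union> f ` C" if x: "x \<in> S" for x
  proof (rule ccontr)
    assume "x \<notin> C \<union> f ` C"
    then have nin: "x \<notin> C" "\<And>y. y \<in> C \<Longrightarrow> x \<noteq> f y" by auto
    \<comment> \<open>The condition defining \<open>F\<close> is directional, so inserting
      \<open>x\<close> requires both \<open>x \<noteq> f y\<close> and
      \<open>y \<noteq> f x\<close>; the second follows from the first since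
      \<open>f (f x) = x\<close>.\<close>
    have "f x \<notin> C"
      using nin(2)[of "f x"] invol[OF x] by auto
    then have "insert x C \<in> F"
      using C nin x by (auto simp: F_def)
    with max[of "insert x C"] nin(1) show False by blast
  qed
  then show thesis
    by (intro that[OF C(1) _ C(2)] subsetI)
qed

section \<open>Edges and cliques in abelian groups and their subgroups\<close>

lemma (in group) ord_subgroup:
  assumes "subgroup H G"
  shows "group.ord (G\<lparr>carrier := H\<rparr>) x = ord x"
  unfolding ord_def group.ord_def[OF subgroup_imp_group[OF assms]]
  by (simp add: nat_pow_def)

text \<open>The set \<open>{x, y}\<close> forgets the order of its elements, so an edge only yields
  one of the two products; commutativity makes them agree.\<close>

lemma (in comm_group) prime_order_edge_iff:
  assumes "x \<in> carrier G" "y \<in> carrier G" "x \<noteq> y"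
  shows "{x, y} \<in> snd (prime_order_element_graph G) \<longleftrightarrow> prime (ord (x \<otimes> y))"
proof -
  have "{x, y} \<in> snd (prime_order_element_graph G) \<longleftrightarrow>
      prime (ord (x \<otimes> y)) \<or> prime (ord (y \<otimes> x))"
    using assms by (auto simp: prime_order_element_graph_def doubleton_eq_iff)
  then show ?thesis
    using m_comm[OF assms(1,2)] by metis
qed

lemma (in comm_group) clique_prime_order_element_graph_iff:
  assumes "C \<subseteq> carrier G"
  shows "clique C (snd (prime_order_element_graph G)) \<longleftrightarrow>
    (\<forall>x\<in>C. \<forall>y\<in>C. x \<noteq> y \<longrightarrow> prime (ord (x \<otimes> y)))"
  using assms by (auto simp: clique_def prime_order_edge_iff subset_iff)

text \<open>Adjacency depends only on the order of a product, which is the same in \<open>H\<close>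
  and in \<open>G\<close>: the graph of a subgroup is an induced subgraph.\<close>

lemma (in comm_group) clique_subgroup_iff:
  assumes H: "subgroup H G" and C: "C \<subseteq> H"
  shows "clique C (snd (prime_order_element_graph (G\<lparr>carrier := H\<rparr>)))
     \<longleftrightarrow> clique C (snd (prime_order_element_graph G))"
proof -
  have HG: "H \<subseteq> carrier G"
    using H subgroup.subset by blast
  then have "comm_group (G\<lparr>carrier := H\<rparr>)"
    using H subgroup_imp_group by (intro group.group_comm_groupI) (auto intro: m_comm)
  from comm_group.clique_prime_order_element_graph_iff[OF this, of C]
  show ?thesis
    using C clique_prime_order_element_graph_iff[OF subset_trans[OF C HG]]
    by (simp add: ord_subgroup[OF H])
qed

section \<open>Element orders in finite p-groups\<close>

lemma (in group) ord_prime_power: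
  assumes "finite_p_group p G" "prime p" "x \<in> carrier G"
  obtains m where "ord x = p ^ m"
proof -
  obtain n where "order G = p ^ n"
    using assms(1) by (auto simp: finite_p_group_def)
  then have "ord x dvd p ^ n"
    using ord_dvd_group_order[OF assms(3)] by simp
  then show thesis
    using that divides_primepow_nat[OF \<open>prime p\<close>] by blast
qed

text \<open>All orders are powers of \<open>p\<close>, so \<open>p\<close> is the only prime among
  them.\<close>

lemma (in group) prime_ord_iff:
  assumes "finite_p_group p G" "prime p" "x \<in> carrier G"
  shows "prime (ord x) \<longleftrightarrow> x [^] p = \<one> \<and> x \<noteq> \<one>"
proof
  assume pr: "prime (ord x)"
  obtain m where m: "ord x = p ^ m"
    using ord_prime_power[OF assms] .
  have "ord x = p"
    using pr \<open>prime p\<close> unfolding m by (metis prime_dvd_power dvd_refl primes_dvd_imp_eq)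
  with pr show "x [^] p = \<one> \<and> x \<noteq> \<one>"
    using assms(3) by (auto simp: pow_eq_id)
next
  assume "x [^] p = \<one> \<and> x \<noteq> \<one>"
  then have "ord x dvd p" "ord x \<noteq> 1"
    using assms(3) ord_eq_1 pow_eq_id by auto
  then show "prime (ord x)"
    using \<open>prime p\<close> by (metis prime_nat_iff)
qed

lemma (in group) odd_ord_finite_p_group:
  assumes "finite_p_group p G" "prime p" "odd p" "x \<in> carrier G"
  shows "odd (ord x)"
  using ord_prime_power[OF assms(1,2,4)] assms(3) by (metis even_power)

text \<open>The order of \<open>x\<close> divides 2 and is odd.\<close>

lemma (in group) square_eq_one_odd_p_group:
  assumes "finite_p_group p G" "prime p" "odd p" "x \<in> carrier G" "x \<otimes> x = \<one>"
  shows "x = \<one>"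
proof -
  have "x [^] (2::nat) = \<one>"
    using assms by (simp add: numeral_2_eq_2)
  then have "ord x dvd 2"
    using assms pow_eq_id by blast
  then have "ord x = 1"
    using odd_ord_finite_p_group[OF assms(1-4)] by (metis dvd_refl prime_nat_iff two_is_prime_nat)
  then show ?thesis
    using assms ord_eq_1 by blast
qed

section \<open>The maximal elementary abelian subgroup as p-torsion\<close>

lemma (in comm_group) subgroup_pow_eq_one: "subgroup {x \<in> carrier G. x [^] (n::nat) = \<one>} G"
proof (rule subgroupI)
  show "{x \<in> carrier G. x [^] n = \<one>} \<noteq> {}"
    using one_closed nat_pow_one by blast
qed (auto simp: nat_pow_inv nat_pow_distrib)

text \<open>The p-torsion subgroup is elementary abelian and contains \<open>H\<close>, so
  maximality forces equality.\<close>

lemma (in comm_group) maximal_elementary_abelian_subgroup_eq: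
  assumes p: "finite_p_group p G" "prime p"
    and max: "maximal_elementary_abelian_subgroup H G"
  shows "H = {x \<in> carrier G. x [^] p = \<one>}" (is "H = ?K")
proof -
  have sub: "subgroup H G" and el: "elementary_abelian (G\<lparr>carrier := H\<rparr>)"
    using max by (auto simp: maximal_elementary_abelian_subgroup_def elementary_abelian_subgroup_def)
  have "group (G\<lparr>carrier := ?K\<rparr>)"
    using subgroup_pow_eq_one subgroup_imp_group by blast
  then have "comm_group (G\<lparr>carrier := ?K\<rparr>)"
    by (rule group.group_comm_groupI) (simp add: m_comm)
  moreover have "ord x = p" if "x \<in> ?K" "x \<noteq> \<one>" for x
  proof -
    have "ord x dvd p" "ord x \<noteq> 1"
      using that ord_eq_1 pow_eq_id by auto
    then show ?thesis
      using \<open>prime p\<close> by (metis prime_nat_iff)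
  qed
  ultimately have "elementary_abelian_subgroup ?K G"
    using p subgroup_pow_eq_one
    by (auto simp: elementary_abelian_subgroup_def elementary_abelian_def ord_subgroup)
  moreover have "H \<subseteq> ?K"
  proof
    fix x assume x: "x \<in> H"
    \<comment> \<open>The prime in \<open>elementary_abelian\<close> is existentially quantified;
      \<open>prime_ord_iff\<close> turns any prime order into exponent \<open>p\<close>.\<close>
    then have "x = \<one> \<or> prime (ord x)"
      using el by (auto simp: elementary_abelian_def ord_subgroup[OF sub])
    with x show "x \<in> ?K"
      using subgroup.mem_carrier[OF sub x] prime_ord_iff[OF p] by auto
  qed
  ultimately show ?thesis
    using max by (auto simp: maximal_elementary_abelian_subgroup_def)
qed

section \<open>Cliques and the p-torsion subgroup\<close>

context comm_group
begin

context
  fixes p :: nat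
    and K :: "'a set"
  assumes p: "finite_p_group p G" "prime p" "odd p"
    and K_def: "K = {x \<in> carrier G. x [^] p = \<one>}"
begin

lemma subgroup_K: "subgroup K G"
  unfolding K_def by (rule subgroup_pow_eq_one)

lemma finite_K: "finite K"
  using p(1) by (simp add: finite_p_group_def K_def)

lemma prime_ord_iff_K: "x \<in> carrier G \<Longrightarrow> prime (ord x) \<longleftrightarrow> x \<in> K - {\<one>}"
  using prime_ord_iff[OF p(1,2)] by (auto simp: K_def)

lemma clique_iff_K:
  assumes "C \<subseteq> carrier G"
  shows "clique C (snd (prime_order_element_graph G)) \<longleftrightarrow>
    (\<forall>x\<in>C. \<forall>y\<in>C. x \<noteq> y \<longrightarrow> x \<otimes> y \<in> K - {\<one>})"
proof -
  have "prime (ord (x \<otimes> y)) \<longleftrightarrow> x \<otimes> y \<in> K - {\<one>}" if "x \<in> C" "y \<in> C" for x y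
    using that assms by (intro prime_ord_iff_K m_closed) auto
  then show ?thesis
    unfolding clique_prime_order_element_graph_iff[OF assms] by auto
qed

text \<open>The element \<open>x [^] p\<close> squares to \<open>\<one>\<close>, hence is
  \<open>\<one>\<close> by odd order.\<close>

lemma square_in_K:
  assumes x: "x \<in> carrier G" "x \<otimes> x \<in> K"
  shows "x \<in> K"
proof -
  have "(x [^] p) \<otimes> (x [^] p) = \<one>"
    using x by (simp add: K_def nat_pow_distrib)
  then show ?thesis
    using square_eq_one_odd_p_group[OF p, of "x [^] p"] x by (simp add: K_def)
qed

text \<open>Two vertices would not suffice: for \<open>x\<close> outside \<open>K\<close> and
  \<open>h\<close> in \<open>K - {\<one>}\<close>, the elements \<open>x\<close> and
  \<open>inv x \<otimes> h\<close> are adjacent and both lie outside \<open>K\<close>.\<close>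

lemma clique_in_K:
  assumes C: "C \<subseteq> carrier G" "clique C (snd (prime_order_element_graph G))" and card: "card C \<ge> 3"
  shows "C \<subseteq> K"
proof
  fix x assume x: "x \<in> C"
  have "\<exists>y z. y \<in> C \<and> z \<in> C \<and> y \<noteq> x \<and> z \<noteq> x \<and> y \<noteq> z"
  proof -
    have "2 \<le> card (C - {x})"
      using card x by simp
    then obtain D where "D \<subseteq> C - {x}" "card D = 2"
      by (meson obtain_subset_with_card_n)
    then show ?thesis
      by (auto simp: card_2_iff)
  qed
  then obtain y z where yz: "y \<in> C" "z \<in> C" "y \<noteq> x" "z \<noteq> x" "y \<noteq> z" by blast
  have c: "x \<in> carrier G" "y \<in> carrier G" "z \<in> carrier G"
    using C(1) x yz by auto
  have *: "x \<otimes> y \<in> K" "x \<otimes> z \<in> K" "y \<otimes> z \<in> K"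
    using C(2) x yz unfolding clique_iff_K[OF C(1)] by auto
  have "(x \<otimes> x) \<otimes> (y \<otimes> z) = (x \<otimes> y) \<otimes> (x \<otimes> z)"
    using c by (simp add: m_ac)
  then have "x \<otimes> x = ((x \<otimes> y) \<otimes> (x \<otimes> z)) \<otimes> inv (y \<otimes> z)"
    using c by (metis inv_solve_right m_closed)
  then have "x \<otimes> x \<in> K"
    using * subgroup_K by (simp add: subgroup.m_closed subgroup.m_inv_closed)
  then show "x \<in> K"
    using c square_in_K by blast
qed

text \<open>\<open>C\<close> and its set of inverses both lie in \<open>K\<close> and share at most
  \<open>\<one>\<close>, so inclusion-exclusion gives the bound.\<close>

lemma clique_in_K_card_le:
  assumes C: "C \<subseteq> K" "clique C (snd (prime_order_element_graph G))"
  shows "2 * card C \<le> card K + 1"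
proof -
  have CG: "C \<subseteq> carrier G"
    using C(1) by (auto simp: K_def)
  have "C \<inter> m_inv G ` C \<subseteq> {\<one>}"
  proof safe
    fix x assume x: "x \<in> C" "inv x \<in> C"
    have xG: "x \<in> carrier G" using x CG by auto
    \<comment> \<open>Otherwise \<open>x\<close> and \<open>inv x\<close> would be adjacent,
      although their product \<open>\<one>\<close> does not have prime order.\<close>
    have "inv x = x"
    proof (rule ccontr)
      assume "inv x \<noteq> x"
      then have "x \<otimes> inv x \<in> K - {\<one>}"
        using clique_iff_K[OF CG, THEN iffD1, OF C(2), rule_format, OF x] by simp
      with xG show False by simp
    qed
    then have "x \<otimes> x = \<one>" using xG by (metis r_inv)
    then have "x = \<one>"
      using square_eq_one_odd_p_group[OF p] xG by blast
    then show "inv x = \<one>" by simp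
  qed
  then have "card (C \<inter> m_inv G ` C) \<le> 1"
    using card_mono[of "{\<one>}"] by force
  moreover have "card (m_inv G ` C) = card C"
    using CG by (intro card_image inj_onI) (metis inv_inv subsetD)
  moreover have "card (C \<union> m_inv G ` C) \<le> card K"
    using C(1) subgroup_K by (intro card_mono finite_K) (auto simp: subgroup.m_inv_closed)
  moreover have "finite C"
    using C(1) finite_K finite_subset by blast
  ultimately show ?thesis
    using card_Un_Int[of C "m_inv G ` C"] by simp
qed

text \<open>Cliques with at most two vertices may leave \<open>K\<close>; for them \<open>K\<close>
  itself is shown to be large enough.\<close>

lemma clique_card_le:
  assumes C: "C \<subseteq> carrier G" "clique C (snd (prime_order_element_graph G))"
  shows "2 * card C \<le> card K + 1"
proof -
  have K1: "\<one> \<in> K"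
    using subgroup_K subgroup.one_closed by blast
  consider "card C \<le> 1" | "card C = 2" | "card C \<ge> 3" by linarith
  then show ?thesis
  proof cases
    case 1
    have "0 < card K"
      using K1 finite_K card_gt_0_iff by blast
    with 1 show ?thesis by linarith
  next
    case 2
    then obtain x y where xy: "C = {x, y}" "x \<noteq> y" by (auto simp: card_2_iff)
    then have z: "x \<otimes> y \<in> K - {\<one>}" and zG: "x \<otimes> y \<in> carrier G"
      using C by (auto simp: clique_iff_K)
    \<comment> \<open>The bound for two vertices needs three elements of \<open>K\<close>:
      \<open>\<one>\<close>, the product along the edge and its inverse.\<close>
    have "inv (x \<otimes> y) \<in> K" "inv (x \<otimes> y) \<noteq> \<one>"
      using z zG subgroup_K by (auto simp: subgroup.m_inv_closed)
    moreover have "inv (x \<otimes> y) \<noteq> x \<otimes> y"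
      using square_eq_one_odd_p_group[OF p zG] z zG by (metis r_inv DiffD2 singletonI)
    ultimately have "card {\<one>, x \<otimes> y, inv (x \<otimes> y)} = 3" "{\<one>, x \<otimes> y, inv (x \<otimes> y)} \<subseteq> K"
      using z K1 by auto
    then have "3 \<le> card K"
      using finite_K card_mono by metis
    with 2 show ?thesis by linarith
  next
    case 3
    then show ?thesis
      using clique_in_K_card_le[OF clique_in_K[OF C] C(2)] by simp
  qed
qed

text \<open>Apply \<open>involution_half\<close> to inversion on \<open>K\<close>: products of
  elements of \<open>K\<close> stay in \<open>K\<close>, so only a pair of distinct mutual inverses
  could spoil a clique.\<close>

lemma ex_large_clique:
  obtains C where "C \<subseteq> K" "clique C (snd (prime_order_element_graph G))" "card K + 1 \<le> 2 * card C"
proof -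
  have KG: "K \<subseteq> carrier G" by (auto simp: K_def)
  have inv_inv_K: "inv (inv x) = x" if "x \<in> K" for x
    using that KG by auto
  obtain C where C: "C \<subseteq> K" "K \<subseteq> C \<union> m_inv G ` C"
    "\<forall>x\<in>C. \<forall>y\<in>C. x \<noteq> y \<longrightarrow> y \<noteq> inv x"
    using involution_half[OF finite_K inv_inv_K] by blast
  have "x \<otimes> y \<in> K - {\<one>}" if xy: "x \<in> C" "y \<in> C" "x \<noteq> y" for x y
  proof -
    have K: "x \<in> K" "y \<in> K" and G: "x \<in> carrier G" "y \<in> carrier G"
      using xy C(1) KG by auto
    have "x \<otimes> y \<noteq> \<one>"
      using C(3)[rule_format, OF xy] inv_equality[of y x] m_comm[OF G] G by metis
    then show ?thesis
      using subgroup.m_closed[OF subgroup_K K] by blast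
  qed
  then have "clique C (snd (prime_order_element_graph G))"
    using C(1) KG by (subst clique_iff_K) auto
  moreover have "card K + 1 \<le> 2 * card C"
  proof -
    have finC: "finite C" using C(1) finite_K finite_subset by blast
    \<comment> \<open>Being its own inverse, \<open>\<one>\<close> lies in \<open>C\<close> and in
      its set of inverses; this overlap accounts for the summand 1.\<close>
    have "\<one> \<in> K"
      using subgroup_K subgroup.one_closed by blast
    then have "\<one> \<in> C \<union> m_inv G ` C"
      using C(2) by blast
    then have "\<one> \<in> C"
      using C(1) KG by (metis UnE imageE inv_eq_1_iff subsetD)
    then have "\<one> \<in> C \<inter> m_inv G ` C"
      by (metis IntI imageI inv_one)
    then have "1 \<le> card (C \<inter> m_inv G ` C)"
      using finC by (metis One_nat_def Suc_leI card_gt_0_iff empty_iff finite_Int)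
    moreover have "card (m_inv G ` C) \<le> card C"
      using finC by (rule card_image_le)
    moreover have "card K \<le> card (C \<union> m_inv G ` C)"
      using C(2) finC by (intro card_mono) auto
    ultimately show ?thesis
      using card_Un_Int[of C "m_inv G ` C"] finC by simp
  qed
  ultimately show thesis
    using that C(1) by blast
qed

text \<open>One clique inside \<open>K\<close> attains the bound in both graphs. The doubled form
  avoids division on \<open>nat\<close>.\<close>

lemma clique_number_prime_order_element_graph:
  shows "2 * clique_number (prime_order_element_graph G) = card K + 1"
    and "2 * clique_number (prime_order_element_graph (G\<lparr>carrier := K\<rparr>)) = card K + 1"
proof -
  obtain C where C: "C \<subseteq> K" "clique C (snd (prime_order_element_graph G))" "card K + 1 \<le> 2 * card C"
    by (rule ex_large_clique)
  have KG: "K \<subseteq> carrier G" by (auto simp: K_def)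
  then have card: "2 * card C = card K + 1"
    using C clique_card_le[of C] by auto
  have "clique_number (prime_order_element_graph G) = card C"
    unfolding clique_number_def
  proof (rule Max_eqI)
    fix n assume "n \<in> {card D | D. D \<subseteq> fst (prime_order_element_graph G) \<and>
      clique D (snd (prime_order_element_graph G))}"
    then obtain D where D: "n = card D" "D \<subseteq> carrier G" "clique D (snd (prime_order_element_graph G))"
      by (auto simp: prime_order_element_graph_def)
    with clique_card_le[of D] card show "n \<le> card C" by linarith
  qed (use C KG p(1) in \<open>auto simp: finite_p_group_def prime_order_element_graph_def\<close>)
  with card show "2 * clique_number (prime_order_element_graph G) = card K + 1" by simp
  have "clique_number (prime_order_element_graph (G\<lparr>carrier := K\<rparr>)) = card C"
    unfolding clique_number_def
  proof (rule Max_eqI)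
    fix n assume "n \<in> {card D | D. D \<subseteq> fst (prime_order_element_graph (G\<lparr>carrier := K\<rparr>)) \<and>
      clique D (snd (prime_order_element_graph (G\<lparr>carrier := K\<rparr>)))}"
    then obtain D where D: "n = card D" "D \<subseteq> K"
      "clique D (snd (prime_order_element_graph (G\<lparr>carrier := K\<rparr>)))"
      by (auto simp: prime_order_element_graph_def)
    with clique_in_K_card_le[of D] clique_subgroup_iff[OF subgroup_K, of D] card show "n \<le> card C" by simp
  next
    show "card C \<in> {card D | D. D \<subseteq> fst (prime_order_element_graph (G\<lparr>carrier := K\<rparr>)) \<and>
      clique D (snd (prime_order_element_graph (G\<lparr>carrier := K\<rparr>)))}"
      using C clique_subgroup_iff[OF subgroup_K, of C] by (auto simp: prime_order_element_graph_def)
  qed (use finite_K in \<open>simp add: prime_order_element_graph_def\<close>)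
  with card show "2 * clique_number (prime_order_element_graph (G\<lparr>carrier := K\<rparr>)) = card K + 1"
    by simp
qed

end

end

theorem theorem5p2:
  fixes G :: "('a, 'b) monoid_scheme" and H :: "'a set" and p k :: nat
  assumes "prime p" and "odd p"
    and "comm_group G" and "finite_p_group p G"
    and "maximal_elementary_abelian_subgroup H G"
    and "G\<lparr>carrier := H\<rparr> \<cong> product_group {..<k} (\<lambda>_. integer_mod_group p)"
  shows "clique_number (prime_order_element_graph G)
           = clique_number (prime_order_element_graph (G\<lparr>carrier := H\<rparr>))
       \<and> real (clique_number (prime_order_element_graph (G\<lparr>carrier := H\<rparr>))) = (real p ^ k + 1) / 2"
proof -
  interpret comm_group G by fact
  have H: "H = {x \<in> carrier G. x [^]\<^bsub>G\<^esub> p = \<one>\<^bsub>G\<^esub>}"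
    using assms by (intro maximal_elementary_abelian_subgroup_eq)
  have "card H = card (carrier (product_group {..<k} (\<lambda>_. integer_mod_group p)))"
    using iso_same_card[OF assms(6)] by simp
  also have "\<dots> = p ^ k"
    \<comment> \<open>Positivity of \<open>p\<close> matters: \<open>integer_mod_group 0\<close> is
      the infinite group of integers.\<close>
    using prime_gt_0_nat[OF assms(1)] by (simp add: card_PiE carrier_integer_mod_group)
  finally have card: "card H = p ^ k" .
  have "2 * clique_number (prime_order_element_graph G) = p ^ k + 1"
    and H2: "2 * clique_number (prime_order_element_graph (G\<lparr>carrier := H\<rparr>)) = p ^ k + 1"
    using clique_number_prime_order_element_graph[OF assms(4,1,2) H] by (simp_all add: card)
  moreover from H2 have "2 * real (clique_number (prime_order_element_graph (G\<lparr>carrier := H\<rparr>)))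
      = real p ^ k + 1"
    by (metis of_nat_1 of_nat_add of_nat_mult of_nat_numeral of_nat_power)
  ultimately show ?thesis by simp
qed

end
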